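(* Let $$A_\infty=\begin{pmatrix} b_0&c_1&&&\\ a_1&b_1&c_2&&\\ &a_2&b_2&c_3&\\ &&\ddots&\ddots&\ddots\end{pmatrix}$$ be an infinite complex (not necessarily symmetric) Jacobi matrix with bounded entries, $\sup_n(|a_n|+|b_n|+|c_n|)<\infty$, and let $A_n$ be its principal (leading) $n\times n$ block. Assume that $$\limsup_{n\to\infty}\sum_{j=1}^n\bigl(|1-a_j|+|b_j|+|1-c_j|\bigr)<\infty.$$ Then $\{A_n\}\sim_\lambda(2\cos t,[-\pi,\pi])$, $\{A_n\}$ is strongly clustered at $[-2,2]$, and every point $s\in[-2,2]$ strongly attracts $\{A_n\}$ with infinite order.
   Context: A matrix sequence $\{A_n\}$ is a sequence of complex matrices with $A_n$ of size $n\times n$; $\lambda_1(A_n),\dots,\lambda_n(A_n)$ are its eigenvalues counted with multiplicity. Distribution: $\{A_n\}\sim_\lambda(\theta,G)$ (distributed as $(\theta,G)$ in the sense of eigenvalues), for a measurable function $\theta$ on a set $G$ of finite positive Lebesgue measure $m(G)$, means that for every continuous $F:\mathbb C\to\mathbb C$ with bounded support, $$\lim_{n\to\infty}\frac1n\sum_{j=1}^nF(\lambda_j(A_n))=\frac1{m(G)}\int_GF(\theta(t))\,dt.$$ Strong clustering: for a nonempty closed $S\subset\mathbb C$ and $\varepsilon>0$ let $D(S,\varepsilon)=\bigcup_{s\in S}\{z\in\mathbb C:|z-s|<\varepsilon\}$. $\{A_n\}$ is strongly clustered at $S$ if for every $\varepsilon>0$ the number of indices $j$ with $\lambda_j(A_n)\notin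 D(S,\varepsilon)$ is $O(1)$ as $n\to\infty$ (bounded by a constant that may depend on $\varepsilon$ but not on $n$). Attraction: a point $s\in\mathbb C$ strongly attracts $\{A_n\}$ with infinite order if, ordering the eigenvalues so that $|\lambda_1(A_n)-s|\le\cdots\le|\lambda_n(A_n)-s|$, one has $\lim_{n\to\infty}|\lambda_j(A_n)-s|=0$ for every fixed $j$. *)

theory Defs
  imports "HOL-Analysis.Analysis" "Jordan_Normal_Form.Char_Poly"
begin

definition matrix_sequence :: "(nat \<Rightarrow> complex mat) \<Rightarrow> bool" where
  "matrix_sequence A \<longleftrightarrow> (\<forall>n. A n \<in> carrier_mat n n)"

text \<open>The eigenvalues with algebraic multiplicity, i.e. as roots of the characteristic polynomial.\<close>

definition eigvals :: "complex mat \<Rightarrow> complex multiset" where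
  "eigvals M = proots (char_poly M)"

lemma size_eigvals: "M \<in> carrier_mat n n \<Longrightarrow> size (eigvals M) = n"
  using degree_monic_char_poly[of M n] by (simp add: eigvals_def size_proots_complex)

text \<open>The first three conjuncts are the standing assumptions on \<open>G\<close> and \<open>\<theta>\<close>; they ensure that the
  Lebesgue integral of \<open>F \<circ> \<theta>\<close> over \<open>G\<close> exists, so that its default value plays no role.\<close>

definition eig_distributed ::
  "(nat \<Rightarrow> complex mat) \<Rightarrow> ('a::euclidean_space \<Rightarrow> complex) \<Rightarrow> 'a set \<Rightarrow> bool" where
  "eig_distributed A \<theta> G \<longleftrightarrow>
     G \<in> lmeasurable \<and> measure lebesgue G > 0 \<and> \<theta> \<in> borel_measurable (lebesgue_on G) \<and>
     (\<forall>F :: complex \<Rightarrow> complex. continuous_on UNIV F \<and> bounded {z. F z \<noteq> 0} \<longrightarrow>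
        (\<lambda>n. (1 / of_nat n) * (\<Sum>z\<in>#eigvals (A n). F z))
          \<longlonglongrightarrow> (1 / of_real (measure lebesgue G)) * (LINT t|lebesgue_on G. F (\<theta> t)))"

definition nbhd :: "complex set \<Rightarrow> real \<Rightarrow> complex set" where
  "nbhd S \<epsilon> = (\<Union>s\<in>S. {z. cmod (z - s) < \<epsilon>})"

definition strongly_clustered :: "(nat \<Rightarrow> complex mat) \<Rightarrow> complex set \<Rightarrow> bool" where
  "strongly_clustered A S \<longleftrightarrow> S \<noteq> {} \<and> closed S \<and>
     (\<forall>\<epsilon>>0. \<exists>C. \<forall>n. size {#z \<in># eigvals (A n). z \<notin> nbhd S \<epsilon>#} \<le> C)"

definition eig_ordering :: "complex \<Rightarrow> complex mat \<Rightarrow> complex list \<Rightarrow> bool" where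
  "eig_ordering s M L \<longleftrightarrow> mset L = eigvals M \<and> sorted (map (\<lambda>z. cmod (z - s)) L)"

lemma eig_ordering_exists: "\<exists>L. eig_ordering s M L"
proof -
  obtain xs where "mset xs = eigvals M" using ex_mset by blast
  then have "eig_ordering s M (sort_key (\<lambda>z. cmod (z - s)) xs)"
    by (simp add: eig_ordering_def)
  then show ?thesis by blast
qed

text \<open>The ordering is unique up to ties, which do not affect the distances to \<open>s\<close>. List positions
  start at 0, so \<open>L n ! j\<close> is the eigenvalue \<open>\<lambda>\<close> of \<open>A n\<close> with index \<open>j + 1\<close>; it is meaningful for
  \<open>n > j\<close>, which is all that the limit for fixed \<open>j\<close> sees.\<close>

definition strongly_attracts_infinite_order :: "complex \<Rightarrow> (nat \<Rightarrow> complex mat) \<Rightarrow> bool" where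
  "strongly_attracts_infinite_order s A \<longleftrightarrow>
     (\<forall>L. (\<forall>n. eig_ordering s (A n) (L n)) \<longrightarrow>
        (\<forall>j. (\<lambda>n. cmod (L n ! j - s)) \<longlonglongrightarrow> 0))"

text \<open>Rows and columns are indexed from 0; row \<open>i\<close> is \<open>(\<dots>, a i, b i, c (i + 1), \<dots>)\<close>, so
  \<open>a 0\<close> and \<open>c 0\<close> do not occur.\<close>

definition jacobi_entry ::
  "(nat \<Rightarrow> complex) \<Rightarrow> (nat \<Rightarrow> complex) \<Rightarrow> (nat \<Rightarrow> complex) \<Rightarrow> nat \<Rightarrow> nat \<Rightarrow> complex" where
  "jacobi_entry a b c i j =
     (if i = j then b i else if i = Suc j then a i else if j = Suc i then c j else 0)"

definition principal_block :: "(nat \<Rightarrow> nat \<Rightarrow> complex) \<Rightarrow> nat \<Rightarrow> complex mat" where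
  "principal_block M n = Matrix.mat n n (\<lambda>(i, j). M i j)"

lemma matrix_sequence_principal_block: "matrix_sequence (principal_block M)"
  by (simp add: matrix_sequence_def principal_block_def)

end

theory Submission
  imports Defs "HOL-Complex_Analysis.Conformal_Mappings" "HOL-Computational_Algebra.Polynomial_FPS"
begin

text \<open>The idea is to pass from the characteristic polynomial to the unit disc. Substituting
  \<open>z = u + 1 / u\<close> (which maps the punctured disc \<open>0 < |u| < 1\<close> onto the complement of
  \<open>[-2, 2]\<close>) and multiplying by \<open>u ^ n\<close> turns the characteristic polynomial of \<open>A n\<close> into
  \<open>q\<^sub>n(u) = \<Prod>\<lambda>. 1 - \<lambda> u + u\<^sup>2\<close>, a polynomial with \<open>q\<^sub>n(0) = 1\<close> whose zeros in the disc are
  the points \<open>v\<close> with \<open>v + 1 / v\<close> an eigenvalue off \<open>[-2, 2]\<close>. Everything is read off from one fact: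
  for each \<open>R < 1\<close> the \<open>q\<^sub>n\<close> are bounded on \<open>|u| \<le> R\<close> uniformly in \<open>n\<close>
  (\<open>disc_poly_jacobi_bounded\<close>). This holds because the three-term recurrence for determinants of
  tridiagonal matrices makes \<open>q\<^sub>n\<close> a summable perturbation of a recurrence whose differences
  \<open>q\<^sub>n\<^sub>+\<^sub>1 - q\<^sub>n\<close> contract by the factor \<open>u\<^sup>2\<close>.

  Clustering: by Jensen's inequality (\<open>jensen_disc_poly\<close>) a holomorphic function that is \<open>1\<close> at the origin
  and bounded by \<open>M\<close> on \<open>|u| = R\<close> has a bounded number of zeros in each smaller disc, and none too
  close to the origin. So only boundedly many eigenvalues keep a given distance from \<open>[-2, 2]\<close>, and
  all eigenvalues lie in one fixed disc.

  Distribution: let \<open>C\<^sub>k\<close> be the polynomial with \<open>C\<^sub>k(u + 1 / u) = u ^ k + 1 / u ^ k\<close>. The Taylor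
  coefficients of the logarithmic derivative of \<open>q\<^sub>n\<close> are, up to sign, the sums of \<open>C\<^sub>k\<close> over the
  eigenvalues. The Taylor coefficients of \<open>q\<^sub>n\<close> are bounded in \<open>n\<close>, hence so are these sums for each
  \<open>k \<ge> 1\<close> (\<open>cheb_sum_bounded\<close>), and the averages of \<open>C\<^sub>k\<close> tend to \<open>0\<close>, which is the mean of
  \<open>C\<^sub>k(2 cos t) = 2 cos (k t)\<close>. Since the \<open>C\<^sub>k\<close> span all polynomials, the limit formula holds for
  polynomials. A continuous function is uniformly close to a polynomial on \<open>[-2, 2]\<close>, hence
  also near it; the boundedly many eigenvalues elsewhere stay in a compact set, so they do not affect
  the average (\<open>averages_tendsto\<close>).

  Attraction: testing the distribution with a bump function at \<open>s\<close> shows that a positive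
  proportion of the eigenvalues lies within any given distance of \<open>s\<close>, so eventually more than
  any fixed number of them do.\<close>

section \<open>Characteristic polynomials of tridiagonal matrices\<close>

lemma det_tridiagonal_Suc_Suc:
  fixes M :: "nat \<Rightarrow> nat \<Rightarrow> 'a :: comm_ring_1"
  assumes tri: "\<And>i j. Suc i < j \<or> Suc j < i \<Longrightarrow> M i j = 0"
  defines "T \<equiv> \<lambda>n. Matrix.mat n n (\<lambda>(i, j). M i j)"
  shows "Determinant.det (T (Suc (Suc n))) =
    M (Suc n) (Suc n) * Determinant.det (T (Suc n)) - M (Suc n) n * M n (Suc n) * Determinant.det (T n)"
proof -
  let ?A = "T (Suc (Suc n))"
  define B where "B = mat_delete ?A (Suc n) n"
  have A: "?A \<in> carrier_mat (Suc (Suc n)) (Suc (Suc n))" by (simp add: T_def)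
  have B: "B \<in> carrier_mat (Suc n) (Suc n)" by (simp add: B_def T_def mat_delete_def)
  \<comment> \<open>Expanding along the last row leaves two minors: the leading block, and a matrix whose last column
      has only its bottom entry, which a second expansion reduces to the next smaller block.\<close>
  have last: "mat_delete ?A (Suc n) (Suc n) = T (Suc n)"
    by (rule eq_matI) (auto simp: T_def mat_delete_def)
  have B_last: "mat_delete B n n = T n"
    by (rule eq_matI) (auto simp: T_def B_def mat_delete_def)
  have B_entry: "B $$ (i, n) = (if i = n then M n (Suc n) else 0)" if "i < Suc n" for i
    using that tri[of i "Suc n"] by (auto simp: T_def B_def mat_delete_def)
  have "Determinant.det B = (\<Sum>i<Suc n. B $$ (i, n) * cofactor B i n)"
    by (rule laplace_expansion_column[OF B]) simp
  also have "\<dots> = M n (Suc n) * cofactor B n n"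
    using B_entry by simp
  also have "\<dots> = M n (Suc n) * Determinant.det (T n)"
    by (simp add: cofactor_def B_last)
  finally have det_B: "Determinant.det B = M n (Suc n) * Determinant.det (T n)" .
  have zero: "?A $$ (Suc n, j) = 0" if "j < n" for j
    using that tri[of "Suc n" j] by (simp add: T_def)
  have "Determinant.det ?A = (\<Sum>j<Suc (Suc n). ?A $$ (Suc n, j) * cofactor ?A (Suc n) j)"
    by (rule laplace_expansion_row[OF A]) simp
  also have "\<dots> = ?A $$ (Suc n, n) * cofactor ?A (Suc n) n
      + ?A $$ (Suc n, Suc n) * cofactor ?A (Suc n) (Suc n)"
    using zero by simp
  finally show ?thesis
    by (simp add: cofactor_def last B_def[symmetric] det_B) (simp add: T_def algebra_simps)
qed

lemma char_poly_principal_block: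
  "char_poly (principal_block M n) =
     Determinant.det (Matrix.mat n n (\<lambda>(i, j). if i = j then [:- M i j, 1:] else [:- M i j:]))"
  unfolding char_poly_def
  by (rule arg_cong[where f = Determinant.det], rule eq_matI)
    (auto simp: char_poly_matrix_def principal_block_def)

lemma char_poly_jacobi:
  fixes a b c :: "nat \<Rightarrow> complex"
  defines "D \<equiv> \<lambda>n. char_poly (principal_block (jacobi_entry a b c) n)"
  shows "D 0 = 1" and "D (Suc 0) = [:- b 0, 1:]"
    and "D (Suc (Suc n)) = [:- b (Suc n), 1:] * D (Suc n) - [:a (Suc n) * c (Suc n):] * D n"
proof -
  let ?M = "\<lambda>i j. if i = j then [:- jacobi_entry a b c i j, 1:] else [:- jacobi_entry a b c i j:]"
  show "D 0 = 1"
    by (simp add: D_def char_poly_principal_block)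
  show "D (Suc 0) = [:- b 0, 1:]"
    unfolding D_def char_poly_principal_block by (subst det_single) (auto simp: jacobi_entry_def)
  show "D (Suc (Suc n)) = [:- b (Suc n), 1:] * D (Suc n) - [:a (Suc n) * c (Suc n):] * D n"
    unfolding D_def char_poly_principal_block
    by (subst det_tridiagonal_Suc_Suc) (auto simp: jacobi_entry_def)
qed

lemma char_poly_eigvals:
  assumes "M \<in> carrier_mat n n"
  shows "char_poly M = (\<Prod>x\<in>#eigvals M. [:- x, 1:])"
  using complex_poly_decompose_multiset[of "char_poly M"] degree_monic_char_poly[OF assms]
  by (simp add: eigvals_def)

section \<open>Transfer to the unit disc\<close>

text \<open>For the eigenvalues of an \<open>n \<times> n\<close> matrix this is \<open>u ^ n\<close> times the characteristic polynomial
  at \<open>u + 1 / u\<close>, as each factor is \<open>u (u + 1 / u - x)\<close>; in this form it makes sense at \<open>u = 0\<close>.\<close>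

definition disc_poly :: "complex multiset \<Rightarrow> complex poly" where
  "disc_poly X = (\<Prod>x\<in>#X. [:1, - x, 1:])"

lemma poly_disc_poly: "poly (disc_poly X) u = (\<Prod>x\<in>#X. 1 - x * u + u\<^sup>2)"
  by (induction X) (auto simp: disc_poly_def algebra_simps power2_eq_square)

lemma poly_disc_poly_0 [simp]: "poly (disc_poly X) 0 = 1"
  by (induction X) (auto simp: disc_poly_def)

lemma poly_disc_poly_eigvals:
  assumes "M \<in> carrier_mat n n" and "u \<noteq> 0"
  shows "poly (disc_poly (eigvals M)) u = u ^ n * poly (char_poly M) (u + 1 / u)"
proof -
  have "(\<Prod>x\<in>#X. 1 - x * u + u\<^sup>2) = u ^ size X * (\<Prod>x\<in>#X. u + 1 / u - x)" for X :: "complex multiset"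
    using \<open>u \<noteq> 0\<close> by (induction X) (auto simp: field_simps power2_eq_square)
  moreover have "poly (\<Prod>x\<in>#X. [:- x, 1:]) z = (\<Prod>x\<in>#X. z - x)" for X and z :: complex
    by (induction X) (auto simp: algebra_simps)
  ultimately show ?thesis
    by (simp add: poly_disc_poly size_eigvals[OF assms(1)] char_poly_eigvals[OF assms(1)])
qed

text \<open>The recurrence of the characteristic polynomials at \<open>u + 1 / u\<close>, multiplied by \<open>u ^ (n + 2)\<close>.
  The origin, where that substitution is undefined, is covered by \<open>q\<^sub>n(0) = 1\<close>.\<close>

lemma disc_poly_jacobi:
  fixes a b c :: "nat \<Rightarrow> complex"
  defines "Q \<equiv> \<lambda>n. disc_poly (eigvals (principal_block (jacobi_entry a b c) n))"
  shows "Q 0 = 1" and "Q (Suc 0) = [:1, - b 0, 1:]"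
    and "Q (Suc (Suc n)) = [:1, - b (Suc n), 1:] * Q (Suc n) - [:0, 0, a (Suc n) * c (Suc n):] * Q n"
proof -
  let ?J = "principal_block (jacobi_entry a b c)"
  have Q_eq: "poly (Q m) u = u ^ m * poly (char_poly (?J m)) (u + 1 / u)" if "u \<noteq> 0" for u m
    using that matrix_sequence_principal_block
    by (simp add: Q_def poly_disc_poly_eigvals matrix_sequence_def)
  have Q_0: "poly (Q m) 0 = 1" for m
    by (simp add: Q_def)
  have "poly (Q 0) u = 1" for u
    by (cases "u = 0") (auto simp: Q_0 Q_eq char_poly_jacobi)
  then show "Q 0 = 1"
    by (simp add: poly_eq_poly_eq_iff[symmetric] fun_eq_iff)
  have "poly (Q (Suc 0)) u = poly [:1, - b 0, 1:] u" for u
    by (cases "u = 0") (auto simp: Q_0 Q_eq char_poly_jacobi field_simps)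
  then show "Q (Suc 0) = [:1, - b 0, 1:]"
    by (simp add: poly_eq_poly_eq_iff[symmetric] fun_eq_iff)
  have "poly (Q (Suc (Suc n))) u =
      poly ([:1, - b (Suc n), 1:] * Q (Suc n) - [:0, 0, a (Suc n) * c (Suc n):] * Q n) u" for u
    by (cases "u = 0") (auto simp: Q_0 Q_eq char_poly_jacobi field_simps power2_eq_square)
  then show "Q (Suc (Suc n)) = [:1, - b (Suc n), 1:] * Q (Suc n) - [:0, 0, a (Suc n) * c (Suc n):] * Q n"
    by (simp add: poly_eq_poly_eq_iff[symmetric] fun_eq_iff)
qed

text \<open>For \<open>\<beta> = 0\<close> and \<open>\<gamma> = 1\<close> the recurrence says that consecutive differences are
  multiplied by \<open>u\<^sup>2\<close>, so its solutions converge geometrically. In general the combination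
  \<open>V n = |x\<^sub>n\<^sub>+\<^sub>1| + K |x\<^sub>n\<^sub>+\<^sub>1 - x\<^sub>n|\<close> is a Lyapunov function: it grows in one step at most by
  the factor \<open>1 + (1 + K) \<delta>\<^sub>n\<close>, where \<open>\<delta>\<^sub>n\<close> measures the perturbation, and these factors have a
  bounded product when the perturbations are summable.\<close>

lemma perturbed_recurrence_bound:
  fixes x \<beta> \<gamma> :: "nat \<Rightarrow> complex" and u :: complex and R B :: real
  assumes rec: "\<And>n. x (Suc (Suc n)) = (1 - \<beta> n * u + u\<^sup>2) * x (Suc n) - \<gamma> n * u\<^sup>2 * x n"
    and u: "cmod u \<le> R" "R < 1"
    and B: "\<And>n. (\<Sum>k<n. cmod (\<beta> k) + cmod (1 - \<gamma> k)) \<le> B"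
  defines "K \<equiv> 1 / (1 - R\<^sup>2)"
  shows "cmod (x (Suc n)) \<le> (cmod (x 1) + K * cmod (x 1 - x 0)) * exp ((1 + K) * B)"
proof -
  define \<delta> where "\<delta> k = cmod (\<beta> k) + cmod (1 - \<gamma> k)" for k
  define V where "V n = cmod (x (Suc n)) + K * cmod (x (Suc n) - x n)" for n
  have "0 \<le> R"
    using u(1) norm_ge_zero[of u] by linarith
  then have R: "0 \<le> R" "R\<^sup>2 < 1"
    using u(2) by (auto simp: abs_square_less_1)
  have K: "1 \<le> K"
    using R by (simp add: K_def)
  have "(1 + K) * R\<^sup>2 = K - (1 - R\<^sup>2)"
    using R by (simp add: K_def divide_simps) (simp add: algebra_simps power2_eq_square)
  \<comment> \<open>This inequality dictates the choice of the weight: the part \<open>R\<^sup>2\<close> of the old difference that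
      survives enters both terms of \<open>V\<close>, and must not outweigh \<open>K\<close>.\<close>
  then have KR: "(1 + K) * R\<^sup>2 \<le> K"
    using R by simp
  have \<delta>_nonneg: "0 \<le> \<delta> k" for k
    by (simp add: \<delta>_def)
  have u1: "cmod u \<le> 1" "(cmod u)\<^sup>2 \<le> 1" "(cmod u)\<^sup>2 \<le> R\<^sup>2"
    using u R by (auto simp: power_mono power_le_one)
  have step: "V (Suc n) \<le> V n * exp ((1 + K) * \<delta> n)" for n
  proof -
    let ?d = "cmod (x (Suc n) - x n)" and ?y = "cmod (x (Suc n))"
    have tri: "cmod (x n) \<le> ?y + ?d"
      by (metis add.commute norm_minus_commute norm_triangle_sub)
    have three: "cmod (p - q + r) \<le> cmod p + cmod q + cmod r" for p q r :: complex
      using norm_triangle_ineq[of "p - q" r] norm_triangle_ineq4[of p q] by linarith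
    have "x (Suc (Suc n)) - x (Suc n) =
        u\<^sup>2 * (x (Suc n) - x n) - \<beta> n * u * x (Suc n) + (1 - \<gamma> n) * u\<^sup>2 * x n"
      by (simp add: rec algebra_simps)
    then have "cmod (x (Suc (Suc n)) - x (Suc n)) \<le>
        (cmod u)\<^sup>2 * ?d + cmod (\<beta> n) * cmod u * ?y + cmod (1 - \<gamma> n) * (cmod u)\<^sup>2 * cmod (x n)"
      using three[of "u\<^sup>2 * (x (Suc n) - x n)" "\<beta> n * u * x (Suc n)" "(1 - \<gamma> n) * u\<^sup>2 * x n"]
      by (simp only: norm_mult norm_power)
    also have "\<dots> \<le> R\<^sup>2 * ?d + cmod (\<beta> n) * 1 * (?y + ?d) + cmod (1 - \<gamma> n) * 1 * (?y + ?d)"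
      using u1 tri by (intro add_mono mult_mono) auto
    also have "\<dots> = R\<^sup>2 * ?d + \<delta> n * (?y + ?d)"
      by (simp add: \<delta>_def algebra_simps)
    finally have d: "cmod (x (Suc (Suc n)) - x (Suc n)) \<le> R\<^sup>2 * ?d + \<delta> n * (?y + ?d)" .
    have "V (Suc n) \<le> ?y + (1 + K) * cmod (x (Suc (Suc n)) - x (Suc n))"
      using norm_triangle_sub[of "x (Suc (Suc n))" "x (Suc n)"] by (simp add: V_def algebra_simps)
    also have "\<dots> \<le> ?y + (1 + K) * (R\<^sup>2 * ?d + \<delta> n * (?y + ?d))"
      using d K by (intro add_left_mono mult_left_mono) auto
    also have "\<dots> = ?y + (1 + K) * R\<^sup>2 * ?d + (1 + K) * \<delta> n * (?y + ?d)"
      by (simp add: algebra_simps)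
    also have "\<dots> \<le> ?y + K * ?d + (1 + K) * \<delta> n * (?y + K * ?d)"
      using KR K \<delta>_nonneg[of n] mult_right_mono[of 1 K ?d]
      by (intro add_mono mult_mono mult_nonneg_nonneg) auto
    also have "\<dots> = V n * (1 + (1 + K) * \<delta> n)"
      by (simp add: V_def algebra_simps)
    also have "\<dots> \<le> V n * exp ((1 + K) * \<delta> n)"
      using K by (intro mult_left_mono exp_ge_add_one_self) (auto simp: V_def)
    finally show ?thesis .
  qed
  have V_le: "V n \<le> V 0 * exp ((1 + K) * (\<Sum>k<n. \<delta> k))" for n
  proof (induction n)
    case (Suc n)
    have "V (Suc n) \<le> (V 0 * exp ((1 + K) * (\<Sum>k<n. \<delta> k))) * exp ((1 + K) * \<delta> n)"
      using step[of n] Suc.IH by (smt (verit) exp_ge_zero mult_right_mono)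
    also have "\<dots> = V 0 * exp ((1 + K) * (\<Sum>k<Suc n. \<delta> k))"
      by (simp add: exp_add[symmetric] distrib_left mult.assoc)
    finally show ?case .
  qed simp
  have "cmod (x (Suc n)) \<le> V n"
    using K by (simp add: V_def)
  also have "\<dots> \<le> V 0 * exp ((1 + K) * (\<Sum>k<n. \<delta> k))"
    by (rule V_le)
  also have "\<dots> \<le> V 0 * exp ((1 + K) * B)"
    using K B[of n] by (intro mult_left_mono) (auto simp: V_def \<delta>_def)
  finally show ?thesis
    by (simp add: V_def)
qed

section \<open>Counting zeros in the disc\<close>

lemma disc_root_exists: "\<exists>v. v \<noteq> 0 \<and> cmod v \<le> 1 \<and> v + 1 / v = z"
proof -
  define w where "w = csqrt (z\<^sup>2 - 4)"
  define v1 v2 where "v1 = (z + w) / 2" and "v2 = (z - w) / 2"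
  have w: "w * w = z * z - 4"
    by (metis w_def power2_csqrt power2_eq_square)
  have prod: "v1 * v2 = 1" and sum: "v1 + v2 = z"
    using w by (simp_all add: v1_def v2_def field_simps)
  have "cmod v1 * cmod v2 = 1"
    by (metis prod norm_mult norm_one)
  then have "cmod v1 \<le> 1 \<or> cmod v2 \<le> 1"
    by (metis less_1_mult linorder_not_le order_less_irrefl)
  moreover have "v1 \<noteq> 0" "v2 \<noteq> 0"
    using prod by auto
  moreover from this have "1 / v1 = v2" "1 / v2 = v1"
    using prod by (simp_all add: nonzero_divide_eq_eq mult.commute)
  ultimately show ?thesis
    using sum by (metis add.commute)
qed

text \<open>The point of the closed unit disc that \<open>v \<mapsto> v + 1 / v\<close> sends to \<open>z\<close>. It is unique off
  \<open>[-2, 2]\<close>; for \<open>z\<close> in the segment every choice has modulus one, and any will do.\<close>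

definition disc_root :: "complex \<Rightarrow> complex" where
  "disc_root z = (SOME v. v \<noteq> 0 \<and> cmod v \<le> 1 \<and> v + 1 / v = z)"

lemma disc_root: "disc_root z \<noteq> 0" "cmod (disc_root z) \<le> 1" "disc_root z + 1 / disc_root z = z"
  using someI_ex[OF disc_root_exists[of z]] by (auto simp: disc_root_def)

lemma disc_root_factor: "1 - z * u + u\<^sup>2 = (1 - u / disc_root z) * (1 - u * disc_root z)"
proof -
  have "z * u = (disc_root z + 1 / disc_root z) * u"
    by (simp add: disc_root)
  then show ?thesis
    using disc_root(1)[of z] by (simp add: field_simps power2_eq_square)
qed

text \<open>Write \<open>z = v + 1 / v\<close> with \<open>v = \<rho> e\<close> and \<open>|e| = 1\<close>. The point \<open>e + 1 / e = 2 Re e\<close> of the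
  segment is at distance at most \<open>(1 - \<rho>) + (1 / \<rho> - 1) = 1 / \<rho> - \<rho>\<close> from \<open>z\<close>, and this is
  less than \<open>\<epsilon>\<close> if \<open>\<rho> > 1 / (1 + \<epsilon> / 2)\<close>, since then \<open>1 / \<rho> < 1 + \<epsilon> / 2\<close> and \<open>\<rho> > 1 - \<epsilon> / 2\<close>.\<close>

lemma disc_root_outside_nbhd:
  assumes "z \<notin> nbhd (complex_of_real ` {-2..2}) \<epsilon>" and "\<epsilon> > 0"
  shows "cmod (disc_root z) \<le> 1 / (1 + \<epsilon> / 2)"
proof (rule ccontr)
  define v where "v = disc_root z"
  define \<rho> where "\<rho> = cmod v"
  define e where "e = v / of_real \<rho>"
  assume "\<not> cmod (disc_root z) \<le> 1 / (1 + \<epsilon> / 2)"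
  then have large: "\<rho> > 1 / (1 + \<epsilon> / 2)"
    by (simp add: \<rho>_def v_def)
  have \<rho>: "0 < \<rho>" "\<rho> \<le> 1"
    using disc_root[of z] by (auto simp: \<rho>_def v_def)
  have e: "cmod e = 1" and v: "v = of_real \<rho> * e"
    using \<rho> by (auto simp: e_def norm_divide \<rho>_def)
  have e0: "e \<noteq> 0"
    using e by auto
  have inv_e: "1 / e = cnj e"
    using e e0 by (simp add: nonzero_divide_eq_eq mult.commute[of "cnj e"] flip: complex_norm_square)
  have z: "z = of_real \<rho> * e + of_real (1 / \<rho>) * cnj e"
    using disc_root(3)[of z] unfolding v_def[symmetric] by (simp add: v inv_e[symmetric])
  have "z - of_real (2 * Re e) = of_real (\<rho> - 1) * e + of_real (1 / \<rho> - 1) * cnj e"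
    unfolding z by (simp add: complex_eq_iff algebra_simps)
  then have "cmod (z - of_real (2 * Re e)) \<le> \<bar>\<rho> - 1\<bar> + \<bar>1 / \<rho> - 1\<bar>"
    by (metis (no_types, lifting) e complex_mod_cnj mult.right_neutral norm_mult norm_of_real norm_triangle_ineq)
  also have "\<dots> = 1 / \<rho> - \<rho>"
    using \<rho> by (simp add: abs_if field_simps)
  also have "\<dots> < \<epsilon>"
  proof -
    have "1 / \<rho> < 1 + \<epsilon> / 2"
      using large \<rho> \<open>\<epsilon> > 0\<close> by (simp add: field_simps)
    moreover have "1 - \<epsilon> / 2 \<le> 1 / (1 + \<epsilon> / 2)"
      using \<open>\<epsilon> > 0\<close> by (simp add: field_simps)
    ultimately show ?thesis
      using large by linarith
  qed
  finally have "cmod (z - of_real (2 * Re e)) < \<epsilon>" .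
  moreover have "2 * Re e \<in> {-2..2}"
    using abs_Re_le_cmod[of e] e by (auto simp: abs_le_iff)
  ultimately have "z \<in> nbhd (complex_of_real ` {-2..2}) \<epsilon>"
    by (auto simp: nbhd_def simp del: of_real_mult)
  with assms(1) show False by simp
qed

lemma maximum_modulus_centre:
  assumes "f holomorphic_on UNIV" and "R > 0" and "\<And>u. cmod u = R \<Longrightarrow> cmod (f u) \<le> M"
  shows "cmod (f 0) \<le> M"
proof (rule maximum_modulus_frontier[where f = f and S = "ball 0 R"])
  show "f holomorphic_on interior (ball 0 R)"
    using assms(1) by (rule holomorphic_on_subset) simp
  show "continuous_on (closure (ball 0 R)) f"
    by (rule continuous_on_subset[OF holomorphic_on_imp_continuous_on[OF assms(1)]]) simp
  show "cmod (f z) \<le> M" if "z \<in> frontier (ball 0 R)" for z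
    using that assms(2,3) by simp
qed (use assms(2) in auto)

text \<open>Jensen's inequality, proved with Blaschke factors: dividing out the zeros \<open>v\<close> with
  \<open>|v| \<le> R\<close> by factors that have modulus one on \<open>|u| = R\<close> leaves a holomorphic function with
  the same bound on the circle, and the modulus of its value at the origin is the product on the left.\<close>

lemma jensen_disc_poly:
  assumes R: "R > 0" and M: "\<And>u. cmod u = R \<Longrightarrow> cmod (poly (disc_poly X) u) \<le> M"
  shows "(\<Prod>z\<in>#X. max 1 (R / cmod (disc_root z))) \<le> M"
proof -
  \<comment> \<open>The factor \<open>1 - z u + u\<^sup>2 = (1 - u / v) (1 - u v)\<close> with \<open>1 - u / v\<close> replaced by its
      reflection in the circle \<open>|u| = R\<close> if \<open>|v| \<le> R\<close>.\<close>
  define h where "h z u =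
    (if cmod (disc_root z) \<le> R
     then (1 - u * disc_root z) * ((of_real (R\<^sup>2) - cnj (disc_root z) * u) / (of_real R * disc_root z))
     else 1 - z * u + u\<^sup>2)" for z u
  define H where "H u = (\<Prod>z\<in>#X. h z u)" for u
  have hol_h: "h z holomorphic_on S" for z S
    using disc_root(1)[of z] R unfolding h_def[abs_def]
    by (cases "cmod (disc_root z) \<le> R") (auto intro!: holomorphic_intros)
  have "(\<lambda>u. \<Prod>z\<in>#Y. h z u) holomorphic_on S" for Y S
    by (induction Y) (auto intro!: holomorphic_on_mult hol_h[unfolded eta_contract_eq] simp: hol_h)
  then have hol: "H holomorphic_on S" for S
    unfolding H_def[abs_def] .
  have h_circle: "cmod (h z u) = cmod (1 - z * u + u\<^sup>2)" if u: "cmod u = R" for z u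
  proof -
    define v where "v = disc_root z"
    have v: "v \<noteq> 0" by (simp add: v_def disc_root)
    have "of_real (R\<^sup>2) = u * cnj u"
      using complex_norm_square[of u] by (simp add: u)
    then have "cmod (of_real (R\<^sup>2) - cnj v * u) = cmod (u * cnj (u - v))"
      by (simp add: algebra_simps)
    also have "\<dots> = R * cmod (u - v)"
      by (metis complex_mod_cnj norm_mult u)
    finally have "cmod ((of_real (R\<^sup>2) - cnj v * u) / (of_real R * v)) = cmod (u - v) / cmod v"
      using R by (simp add: norm_divide norm_mult)
    also have "\<dots> = cmod (1 - u / v)"
    proof -
      have "1 - u / v = (v - u) / v"
        using v by (simp add: field_simps)
      then show ?thesis
        by (simp add: norm_divide norm_minus_commute)
    qed
    finally have quot: "cmod ((of_real (R\<^sup>2) - cnj v * u) / (of_real R * v)) = cmod (1 - u / v)" .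
    have "cmod ((1 - u * v) * ((of_real (R\<^sup>2) - cnj v * u) / (of_real R * v))) = cmod (1 - z * u + u\<^sup>2)"
      by (simp only: norm_mult[of "1 - u * v"] norm_mult[of "1 - u / v"] quot
          disc_root_factor[of z u] v_def[symmetric] mult.commute[of "cmod (1 - u * v)"])
    then show ?thesis
      by (simp only: h_def v_def[symmetric] split: if_split) simp
  qed
  have "cmod (\<Prod>z\<in>#Y. h z u) = cmod (\<Prod>z\<in>#Y. 1 - z * u + u\<^sup>2)" if "cmod u = R" for Y u
    by (induction Y) (simp_all add: norm_mult h_circle[OF that])
  then have "cmod (H u) \<le> M" if "cmod u = R" for u
    using M[OF that] that by (simp add: H_def poly_disc_poly)
  then have "cmod (H 0) \<le> M"
    by (rule maximum_modulus_centre[OF hol R])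
  have h0: "cmod (h z 0) = max 1 (R / cmod (disc_root z))" for z
    using disc_root(1)[of z] R
    by (auto simp: h_def norm_divide norm_mult max_def field_simps power2_eq_square)
  have "cmod (\<Prod>z\<in>#Y. h z 0) = (\<Prod>z\<in>#Y. max 1 (R / cmod (disc_root z)))" for Y
    by (induction Y) (simp_all add: norm_mult h0)
  with \<open>cmod (H 0) \<le> M\<close> show ?thesis
    by (simp add: H_def)
qed

section \<open>Power sums of Chebyshev type\<close>

lemma holomorphic_on_poly: "poly p holomorphic_on S"
  unfolding holomorphic_on_def field_differentiable_def
  using has_field_derivative_at_within[OF poly_DERIV] by blast

text \<open>A weak form of the Cauchy estimates, by peeling off the constant coefficient: for
  \<open>p(u) = a + u q(u)\<close> the maximum principle gives \<open>|a| \<le> M\<close>, hence \<open>|q| \<le> 2 M / r\<close> on the circle.\<close>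

lemma coeff_bound_on_circle:
  fixes p :: "complex poly"
  assumes "r > 0" and "\<And>u. cmod u = r \<Longrightarrow> cmod (poly p u) \<le> M"
  shows "cmod (coeff p k) \<le> M * (2 / r) ^ k"
  using assms(2)
proof (induction k arbitrary: p M)
  case (0 p M)
  have "cmod (poly p 0) \<le> M"
    by (rule maximum_modulus_centre[OF holomorphic_on_poly \<open>r > 0\<close> 0])
  then show ?case by (simp add: poly_0_coeff_0)
next
  case (Suc k p M)
  obtain a q where p: "p = pCons a q" by (cases p)
  have "cmod (poly p 0) \<le> M"
    by (rule maximum_modulus_centre[OF holomorphic_on_poly \<open>r > 0\<close> Suc.prems])
  then have a: "cmod a \<le> M" by (simp add: p)
  have "cmod (poly q u) \<le> M * (2 / r)" if "cmod u = r" for u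
  proof -
    have "r * cmod (poly q u) = cmod (poly p u - a)"
      using that by (simp add: p norm_mult)
    also have "\<dots> \<le> M + M"
      using norm_triangle_ineq4[of "poly p u" a] Suc.prems[OF that] a by linarith
    finally show ?thesis
      using \<open>r > 0\<close> by (simp add: field_simps)
  qed
  from Suc.IH[OF this] show ?case by (simp add: p mult.assoc)
qed

text \<open>These are the Chebyshev polynomials \<open>C\<^sub>k(z) = 2 T\<^sub>k(z / 2)\<close>. In this normalisation they are
  monic for \<open>k \<ge> 1\<close>, and \<open>C\<^sub>k(u + 1 / u) = u ^ k + 1 / u ^ k\<close>.\<close>

fun cheb_poly :: "nat \<Rightarrow> complex poly" where
  "cheb_poly 0 = [:2:]"
| "cheb_poly (Suc 0) = [:0, 1:]"
| "cheb_poly (Suc (Suc k)) = [:0, 1:] * cheb_poly (Suc k) - cheb_poly k"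

lemma degree_cheb_poly:
  "degree (cheb_poly (Suc k)) = Suc k \<and> lead_coeff (cheb_poly (Suc k)) = 1"
proof (induction k rule: less_induct)
  case (less k)
  show ?case
  proof (cases k)
    case (Suc j)
    define P where "P = [:0, 1:] * cheb_poly (Suc j)"
    have IH: "degree (cheb_poly (Suc j)) = Suc j" "lead_coeff (cheb_poly (Suc j)) = 1"
      using less.IH[of j] Suc by auto
    then have P: "degree P = Suc (Suc j)" "lead_coeff P = 1"
      by (auto simp: P_def degree_pCons_eq_if)
    have "degree (cheb_poly j) < degree P"
    proof (cases j)
      case (Suc i)
      then show ?thesis using less.IH[of i] \<open>k = Suc j\<close> P by simp
    qed (use P in simp)
    then have "degree (- cheb_poly j) < degree P" by simp
    then have "degree (P + - cheb_poly j) = degree P" "lead_coeff (P + - cheb_poly j) = lead_coeff P"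
      by (simp_all add: degree_add_eq_left coeff_eq_0 del: add_uminus_conv_diff)
    then show ?thesis using P Suc by (simp add: P_def coeff_eq_0)
  qed simp
qed

lemma poly_cheb_poly_cos: "poly (cheb_poly k) (of_real (2 * cos t)) = of_real (2 * cos (of_nat k * t))"
proof (induction k rule: cheb_poly.induct)
  case (3 k)
  have "cos (real (Suc (Suc k)) * t) + cos (real k * t) = 2 * cos t * cos (real (Suc k) * t)"
  proof -
    have "real (Suc (Suc k)) * t = real (Suc k) * t + t" "real k * t = real (Suc k) * t - t"
      by (simp_all add: algebra_simps)
    then show ?thesis by (simp only: cos_add cos_diff) (simp add: algebra_simps)
  qed
  then have "2 * cos (real (Suc (Suc k)) * t) = 2 * cos t * (2 * cos (real (Suc k) * t)) - 2 * cos (real k * t)"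
    by (simp add: algebra_simps)
  then have "complex_of_real (2 * cos (real (Suc (Suc k)) * t)) =
      of_real (2 * cos t * (2 * cos (real (Suc k) * t)) - 2 * cos (real k * t))"
    by (rule arg_cong)
  also have "\<dots> = of_real (2 * cos t) * of_real (2 * cos (real (Suc k) * t)) - of_real (2 * cos (real k * t))"
    by (simp only: of_real_mult of_real_diff)
  finally have step: "complex_of_real (2 * cos (real (Suc (Suc k)) * t)) = \<dots>" .
  have "poly (cheb_poly (Suc (Suc k))) x = x * poly (cheb_poly (Suc k)) x - poly (cheb_poly k) x" for x
    by simp
  then show ?case
    by (simp only: 3 step)
qed auto

definition cheb_sum :: "complex multiset \<Rightarrow> nat \<Rightarrow> complex" where
  "cheb_sum X k = (\<Sum>z\<in>#X. poly (cheb_poly k) z)"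

text \<open>The generating function of the Chebyshev polynomials: multiplying the series by
  \<open>1 - z u + u\<^sup>2\<close> produces the defining recurrence in every coefficient of order at least two.\<close>

lemma fps_deriv_disc_factor:
  "fps_deriv (fps_of_poly [:1, - z, 1:]) =
     - fps_of_poly [:1, - z, 1:] * Abs_fps (\<lambda>k. poly (cheb_poly (Suc k)) z)" (is "_ = - ?f * ?G")
proof (rule fps_ext)
  fix k
  have f: "?f = 1 - fps_const z * fps_X + fps_X * fps_X"
    by (simp add: fps_of_poly_pCons algebra_simps)
  have "fps_nth (?f * ?G) k =
     fps_nth ?G k - z * (if k = 0 then 0 else fps_nth ?G (k - 1))
     + (if k = 0 then 0 else if k - 1 = 0 then 0 else fps_nth ?G (k - 1 - 1))"
    unfolding f by (simp add: algebra_simps mult.assoc)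
  also have "\<dots> = - fps_nth (fps_deriv ?f) k"
  proof -
    consider "k = 0" | "k = 1" | j where "k = Suc (Suc j)"
      by (metis One_nat_def not0_implies_Suc)
    then show ?thesis
      by cases (auto simp: coeff_pCons)
  qed
  finally show "fps_nth (fps_deriv ?f) k = fps_nth (- ?f * ?G) k"
    by simp
qed

text \<open>The logarithmic derivative of a product is the sum of those of its factors.\<close>

lemma fps_deriv_disc_poly:
  "fps_deriv (fps_of_poly (disc_poly X)) =
     - fps_of_poly (disc_poly X) * Abs_fps (\<lambda>k. cheb_sum X (Suc k))"
proof (induction X)
  case empty
  have "Abs_fps (\<lambda>k. 0 :: complex) = 0" by (simp add: fps_eq_iff)
  then show ?case by (simp add: disc_poly_def cheb_sum_def)
next
  case (add z X)
  have "Abs_fps (\<lambda>k. cheb_sum (add_mset z X) (Suc k)) =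
      Abs_fps (\<lambda>k. poly (cheb_poly (Suc k)) z) + Abs_fps (\<lambda>k. cheb_sum X (Suc k))"
    by (simp add: cheb_sum_def fps_eq_iff)
  moreover have "disc_poly (add_mset z X) = [:1, - z, 1:] * disc_poly X"
    by (simp add: disc_poly_def)
  ultimately show ?case
    by (simp only: fps_of_poly_mult fps_deriv_mult add.IH fps_deriv_disc_factor) (simp add: algebra_simps)
qed

text \<open>The analogue of Newton's identities: comparing coefficients in \<open>fps_deriv_disc_poly\<close>
  expresses each Chebyshev sum through coefficients of \<open>disc_poly X\<close> and earlier sums. As only
  finitely many coefficients enter, bounds on them that hold uniformly in \<open>X\<close> carry over to the sums.\<close>

lemma newton_identity:
  "cheb_sum X (Suc k) =
     - of_nat (Suc k) * coeff (disc_poly X) (Suc k)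
     - (\<Sum>i<k. coeff (disc_poly X) (k - i) * cheb_sum X (Suc i))"
proof -
  have c0: "coeff (disc_poly X) 0 = 1"
    by (metis poly_0_coeff_0 poly_disc_poly_0)
  have "of_nat (Suc k) * coeff (disc_poly X) (Suc k) = fps_nth (fps_deriv (fps_of_poly (disc_poly X))) k"
    by simp
  also have "\<dots> = - (\<Sum>i=0..k. cheb_sum X (Suc i) * coeff (disc_poly X) (k - i))"
    unfolding fps_deriv_disc_poly
    by (simp add: mult.commute[of "fps_of_poly (disc_poly X)"] fps_mult_nth)
  also have "\<dots> = - ((\<Sum>i<k. coeff (disc_poly X) (k - i) * cheb_sum X (Suc i)) + cheb_sum X (Suc k))"
    by (simp add: atLeast0AtMost lessThan_Suc_atMost[symmetric] c0 mult.commute)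
  finally have eq: "of_nat (Suc k) * coeff (disc_poly X) (Suc k) = \<dots>" .
  show ?thesis
    unfolding mult_minus_left eq by simp
qed

lemma cheb_sum_bounded:
  assumes "\<And>k. \<exists>B. \<forall>n. cmod (coeff (disc_poly (X n)) k) \<le> B"
  shows "\<exists>B. \<forall>n. cmod (cheb_sum (X n) (Suc k)) \<le> B"
proof (induction k rule: less_induct)
  case (less k)
  obtain D where D: "\<And>k n. cmod (coeff (disc_poly (X n)) k) \<le> D k"
    using assms by metis
  obtain E where E: "\<And>i n. i < k \<Longrightarrow> cmod (cheb_sum (X n) (Suc i)) \<le> E i"
    using less.IH by metis
  have "cmod (cheb_sum (X n) (Suc k)) \<le> real (Suc k) * D (Suc k) + (\<Sum>i<k. D (k - i) * E i)" for n
  proof -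
    let ?q = "coeff (disc_poly (X n))" and ?s = "\<lambda>i. cheb_sum (X n) (Suc i)"
    have "cmod (?s k) \<le> cmod (- of_nat (Suc k) * ?q (Suc k)) + cmod (\<Sum>i<k. ?q (k - i) * ?s i)"
      by (subst newton_identity) (rule norm_triangle_ineq4)
    also have "cmod (- of_nat (Suc k) * ?q (Suc k)) \<le> real (Suc k) * D (Suc k)"
      unfolding norm_mult norm_minus_cancel norm_of_nat by (intro mult_left_mono D) auto
    also have "cmod (\<Sum>i<k. ?q (k - i) * ?s i) \<le> (\<Sum>i<k. D (k - i) * E i)"
      unfolding norm_mult[symmetric]
      using D E by (intro sum_norm_le) (auto simp: norm_mult intro!: mult_mono order_trans[OF norm_ge_zero D])
    finally show ?thesis by simp
  qed
  then show ?case by blast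
qed

section \<open>The mean over the segment\<close>

abbreviation segment :: "complex set" where
  "segment \<equiv> complex_of_real ` {-2..2}"

text \<open>The integral against the arcsine distribution on \<open>[-2, 2]\<close>, the image of the normalised
  Lebesgue measure on \<open>[-pi, pi]\<close> under \<open>t \<mapsto> 2 cos t\<close>. It is written as a gauge integral, for which
  the fundamental theorem of calculus is available; \<open>arcsine_mean_lebesgue\<close> relates it to the Lebesgue
  integral.\<close>

definition arcsine_mean :: "(complex \<Rightarrow> complex) \<Rightarrow> complex" where
  "arcsine_mean F = integral {-pi..pi} (\<lambda>t. F (of_real (2 * cos t))) / of_real (2 * pi)"

lemma arcsine_mean_integrable:
  fixes F :: "complex \<Rightarrow> complex"
  assumes "continuous_on UNIV F"
  shows "continuous_on {-pi..pi} (\<lambda>t. F (of_real (2 * cos t)))"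
    and "(\<lambda>t. F (of_real (2 * cos t))) integrable_on {-pi..pi}"
proof -
  show cont: "continuous_on {-pi..pi} (\<lambda>t. F (of_real (2 * cos t)))"
    by (rule continuous_on_compose2[OF assms]) (auto intro!: continuous_intros)
  then show "(\<lambda>t. F (of_real (2 * cos t))) integrable_on {-pi..pi}"
    by (rule integrable_continuous_real)
qed

lemma arcsine_mean_lebesgue:
  assumes "continuous_on UNIV F"
  shows "(1 / of_real (measure lebesgue {-pi..pi})) *
      (LINT t|lebesgue_on {-pi..pi}. F (of_real (2 * cos t))) = arcsine_mean F"
  using lebesgue_integral_eq_integral[OF continuous_imp_integrable_real[OF arcsine_mean_integrable(1)[OF assms]]]
  by (simp add: arcsine_mean_def)

lemma arcsine_mean_const: "arcsine_mean (\<lambda>_. c) = c"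
  by (simp add: arcsine_mean_def scaleR_conv_of_real)

lemma arcsine_mean_add:
  assumes "continuous_on UNIV F" "continuous_on UNIV G"
  shows "arcsine_mean (\<lambda>z. F z + G z) = arcsine_mean F + arcsine_mean G"
  unfolding arcsine_mean_def
    integral_add[OF arcsine_mean_integrable(2)[OF assms(1)] arcsine_mean_integrable(2)[OF assms(2)]]
  by (rule add_divide_distrib)

lemma arcsine_mean_cmult: "arcsine_mean (\<lambda>z. c * F z) = c * arcsine_mean F"
  by (simp add: arcsine_mean_def)

lemma arcsine_mean_dist_le:
  assumes "continuous_on UNIV F" "continuous_on UNIV G"
    and close: "\<And>z. z \<in> segment \<Longrightarrow> cmod (F z - G z) \<le> e"
  shows "cmod (arcsine_mean F - arcsine_mean G) \<le> e"
proof -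
  let ?d = "\<lambda>t. F (of_real (2 * cos t)) - G (of_real (2 * cos t))"
  have bound: "cmod (integral {-pi..pi} ?d) \<le> e * (pi - (- pi))"
  proof (rule integral_bound)
    show "continuous_on {-pi..pi} ?d"
      using assms by (intro continuous_on_diff arcsine_mean_integrable(1))
    show "cmod (?d t) \<le> e" for t
      by (rule close) (auto intro!: image_eqI[of _ _ "2 * cos t"])
  qed auto
  have "arcsine_mean F - arcsine_mean G = integral {-pi..pi} ?d / of_real (2 * pi)"
    unfolding arcsine_mean_def
      integral_diff[OF arcsine_mean_integrable(2)[OF assms(1)] arcsine_mean_integrable(2)[OF assms(2)]]
    by (rule diff_divide_distrib[symmetric])
  then have "cmod (arcsine_mean F - arcsine_mean G) = cmod (integral {-pi..pi} ?d) / (2 * pi)"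
    by (simp only: norm_divide norm_of_real) simp
  also have "\<dots> \<le> e * (pi - (- pi)) / (2 * pi)"
    using bound by (rule divide_right_mono) simp
  finally show ?thesis by simp
qed

lemma arcsine_mean_cheb_poly: "arcsine_mean (poly (cheb_poly (Suc k))) = 0"
proof -
  define m where "m = real (Suc k)"
  have m: "m > 0" by (simp add: m_def)
  have "((\<lambda>t. 2 * cos (m * t)) has_integral (2 * sin (m * pi) / m - 2 * sin (m * (- pi)) / m)) {-pi..pi}"
    using m
    by (intro fundamental_theorem_of_calculus)
      (auto intro!: derivative_eq_intros simp: has_real_derivative_iff_has_vector_derivative[symmetric])
  moreover have "sin (m * pi) = 0"
    unfolding m_def by (metis mult.commute sin_npi2)
  ultimately have "((\<lambda>t. 2 * cos (m * t)) has_integral 0) {-pi..pi}"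
    by simp
  then have "integral {-pi..pi} (\<lambda>t. complex_of_real (2 * cos (m * t))) = of_real 0"
    by (intro integral_unique has_integral_of_real)
  then show ?thesis
    unfolding arcsine_mean_def poly_cheb_poly_cos m_def[symmetric] by (simp only: of_real_0 div_0)
qed

section \<open>Convergence of averages\<close>

lemma sum_mset_norm_le:
  assumes "\<And>z. z \<in># X \<Longrightarrow> cmod (f z) \<le> g z"
  shows "cmod (\<Sum>z\<in>#X. f z) \<le> (\<Sum>z\<in>#X. g z)"
  using assms
proof (induction X)
  case (add z X)
  then have "cmod (\<Sum>z\<in>#X. f z) \<le> (\<Sum>z\<in>#X. g z)" "cmod (f z) \<le> g z" by auto
  then show ?case using norm_triangle_ineq[of "f z" "\<Sum>z\<in>#X. f z"] by simp
qed simp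

lemma sum_mset_cond:
  "(\<Sum>z\<in>#X. if P z then d else (0::real)) = d * real (size (filter_mset P X))"
  by (induction X) (auto simp: algebra_simps)

text \<open>Subtracting a multiple of \<open>cheb_poly\<close> of the same degree lowers the degree of a polynomial. The
  subtracted term has bounded sums, so its averages vanish in the limit, as does its mean.\<close>

lemma poly_averages_tendsto:
  assumes size: "\<And>n. size (X n) = n"
    and cheb: "\<And>k. \<exists>B. \<forall>n. cmod (cheb_sum (X n) (Suc k)) \<le> B"
  shows "(\<lambda>n. (1 / of_nat n) * (\<Sum>z\<in>#X n. poly p z)) \<longlonglongrightarrow> arcsine_mean (poly p)"
proof (induction "degree p" arbitrary: p rule: less_induct)
  case less
  show ?case
  proof (cases "degree p")
    case 0
    then obtain c where p: "p = [:c:]" by (metis degree_eq_zeroE)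
    have "eventually (\<lambda>n. (1 / of_nat n) * (\<Sum>z\<in>#X n. poly p z) = c) sequentially"
      using eventually_gt_at_top[of 0] by eventually_elim (simp add: p size)
    moreover have "poly p = (\<lambda>_. c)"
      by (auto simp: p)
    then have "arcsine_mean (poly p) = c"
      by (simp only: arcsine_mean_const)
    ultimately show ?thesis
      by (simp add: tendsto_eventually)
  next
    case (Suc k)
    define l where "l = lead_coeff p"
    define q where "q = p - Polynomial.smult l (cheb_poly (Suc k))"
    have C: "degree (cheb_poly (Suc k)) = Suc k" "coeff (cheb_poly (Suc k)) (Suc k) = 1"
      using degree_cheb_poly[of k] by auto
    have "degree q < degree p"
    proof -
      have "l \<noteq> 0" by (metis Suc degree_0 leading_coeff_0_iff nat.distinct(1) l_def)
      then have "degree (Polynomial.smult l (cheb_poly (Suc k))) = degree p"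
        using C Suc by simp
      then have "degree q \<le> degree p"
        by (simp add: q_def degree_diff_le)
      moreover have "coeff q (degree p) = 0"
        using C Suc by (simp add: q_def l_def)
      ultimately show ?thesis
        by (metis Suc eq_zero_or_degree_less degree_0 zero_less_Suc)
    qed
    then have q: "(\<lambda>n. (1 / of_nat n) * (\<Sum>z\<in>#X n. poly q z)) \<longlonglongrightarrow> arcsine_mean (poly q)"
      by (rule less)
    have p: "poly p z = poly q z + l * poly (cheb_poly (Suc k)) z" for z
      by (simp add: q_def)
    obtain B where B: "\<And>n. cmod (cheb_sum (X n) (Suc k)) \<le> B"
      using cheb by blast
    have cheb_lim: "(\<lambda>n. (1 / of_nat n) * cheb_sum (X n) (Suc k)) \<longlonglongrightarrow> 0"
    proof (rule Lim_null_comparison)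
      show "eventually (\<lambda>n. cmod ((1 / of_nat n) * cheb_sum (X n) (Suc k)) \<le> B / real n) sequentially"
        using B by (intro always_eventually allI) (simp add: norm_divide divide_right_mono)
      show "(\<lambda>n. B / real n) \<longlonglongrightarrow> 0"
        by (rule lim_const_over_n)
    qed
    have "(1 / of_nat n) * (\<Sum>z\<in>#X n. poly p z) =
        (1 / of_nat n) * (\<Sum>z\<in>#X n. poly q z) + l * ((1 / of_nat n) * cheb_sum (X n) (Suc k))" for n
    proof -
      have "(\<Sum>z\<in>#X n. poly p z) = (\<Sum>z\<in>#X n. poly q z) + l * cheb_sum (X n) (Suc k)"
        by (simp add: p cheb_sum_def sum_mset.distrib sum_mset_distrib_left multiset.map_comp comp_def)
      then show ?thesis by (simp only: distrib_left mult.left_commute)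
    qed
    moreover have "arcsine_mean (poly p) = arcsine_mean (poly q) + l * 0"
      unfolding p arcsine_mean_cheb_poly[symmetric, of k] arcsine_mean_cmult[symmetric]
      by (intro arcsine_mean_add continuous_intros)
    ultimately show ?thesis
      using tendsto_add[OF q tendsto_mult_left[OF cheb_lim, of l]] by simp
  qed
qed

lemma complex_poly_approx_on_segment:
  assumes "continuous_on UNIV F" and "e > 0"
  obtains p where "\<And>z. z \<in> segment \<Longrightarrow> cmod (F z - poly p z) < e"
proof -
  have *: "\<exists>p. \<forall>x\<in>{-2..2}. \<bar>g x - Re (poly p (of_real x))\<bar> < e / 2 \<and> Im (poly p (of_real x)) = 0"
    if cont_g: "continuous_on {-2..2} g" for g :: "real \<Rightarrow> real"
  proof -
    obtain h where "real_polynomial_function h" and h: "\<And>x. x \<in> {-2..2} \<Longrightarrow> \<bar>g x - h x\<bar> < e / 2"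
      using Stone_Weierstrass_real_polynomial_function[OF _ cont_g, of "e / 2"] \<open>e > 0\<close> by auto
    then obtain a n where ha: "h = (\<lambda>x. \<Sum>i\<le>n. a i * x ^ i)"
      by (auto simp: real_polynomial_function_iff_sum)
    define p where "p = (\<Sum>i\<le>n. monom (complex_of_real (a i)) i)"
    have "poly p (of_real x) = of_real (h x)" for x
      by (simp add: p_def ha poly_sum poly_monom)
    then show ?thesis using h by (intro exI[of _ p]) auto
  qed
  have cont: "continuous_on {-2..2} (\<lambda>x. F (complex_of_real x))"
    by (rule continuous_on_compose2[OF assms(1)]) (auto intro!: continuous_intros)
  obtain p where p: "\<forall>x\<in>{-2..2}. \<bar>Re (F (of_real x)) - Re (poly p (of_real x))\<bar> < e / 2 \<and> Im (poly p (of_real x)) = 0"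
    using *[OF continuous_on_Re[OF cont]] by blast
  obtain q where q: "\<forall>x\<in>{-2..2}. \<bar>Im (F (of_real x)) - Re (poly q (of_real x))\<bar> < e / 2 \<and> Im (poly q (of_real x)) = 0"
    using *[OF continuous_on_Im[OF cont]] by blast
  have "cmod (F z - poly (p + Polynomial.smult \<i> q) z) < e" if z: "z \<in> segment" for z
  proof -
    obtain x where x: "x \<in> {-2..2}" "z = of_real x" using z by blast
    let ?d = "F z - poly (p + Polynomial.smult \<i> q) z"
    have "\<bar>Re ?d\<bar> < e / 2" "\<bar>Im ?d\<bar> < e / 2"
      using p q x by auto
    then show ?thesis using cmod_le[of ?d] by linarith
  qed
  then show ?thesis by (rule that)
qed

text \<open>Split \<open>F = p + g\<close> with a polynomial \<open>p\<close> such that \<open>g\<close> is small on the segment. By continuity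
  \<open>g\<close> is small on a neighbourhood of the segment as well; the boundedly many points outside it
  contribute a bounded amount to the sum of \<open>g\<close>, because \<open>g\<close> is bounded on the disc containing all
  the points.\<close>

lemma averages_tendsto:
  assumes size: "\<And>n. size (X n) = n"
    and cheb: "\<And>k. \<exists>B. \<forall>n. cmod (cheb_sum (X n) (Suc k)) \<le> B"
    and cluster: "\<And>\<epsilon>. \<epsilon> > 0 \<Longrightarrow> \<exists>C. \<forall>n. size {#z \<in># X n. z \<notin> nbhd segment \<epsilon>#} \<le> C"
    and bounded: "\<And>n z. z \<in># X n \<Longrightarrow> cmod z \<le> B"
    and F: "continuous_on UNIV F"
  shows "(\<lambda>n. (1 / of_nat n) * (\<Sum>z\<in>#X n. F z)) \<longlonglongrightarrow> arcsine_mean F"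
proof (rule tendstoI)
  fix e :: real assume "e > 0"
  \<comment> \<open>Two quarters of \<open>e\<close> go to the average of \<open>g\<close> near and off the segment, one to the limit for \<open>p\<close>,
      and one to the difference of the two means.\<close>
  define e' where "e' = e / 4"
  have e': "e' > 0" using \<open>e > 0\<close> by (simp add: e'_def)
  obtain p where p: "\<And>z. z \<in> segment \<Longrightarrow> cmod (F z - poly p z) < e'"
    using complex_poly_approx_on_segment[OF F e'] by blast
  define g where "g z = F z - poly p z" for z
  have g: "continuous_on UNIV g"
    unfolding g_def[abs_def] using F by (intro continuous_intros)
  have op: "open {z. cmod (g z) < e'}"
    using g by (intro open_Collect_less continuous_intros)
  have cpt: "compact segment"
    by (intro compact_continuous_image continuous_intros) auto
  have sub: "segment \<subseteq> {z. cmod (g z) < e'}"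
    using p by (auto simp: g_def)
  obtain \<epsilon> where \<epsilon>: "\<epsilon> > 0" "(\<Union>x\<in>segment. ball x \<epsilon>) \<subseteq> {z. cmod (g z) < e'}"
    using compact_subset_open_imp_ball_epsilon_subset[OF cpt op sub] by blast
  have near: "cmod (g z) < e'" if "z \<in> nbhd segment \<epsilon>" for z
    using that \<epsilon>(2) by (auto simp: nbhd_def dist_norm norm_minus_commute subset_iff)
  obtain C where C: "\<And>n. size {#z \<in># X n. z \<notin> nbhd segment \<epsilon>#} \<le> C"
    using cluster[OF \<epsilon>(1)] by blast
  have "compact (g ` cball 0 B)"
    by (intro compact_continuous_image continuous_on_subset[OF g]) auto
  then obtain D where D: "D > 0" "\<And>z. cmod z \<le> B \<Longrightarrow> cmod (g z) \<le> D"
    by (auto simp: bounded_pos dest!: compact_imp_bounded)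
  have remainder: "cmod ((1 / of_nat n) * (\<Sum>z\<in>#X n. g z)) \<le> e' + D * real C / real n" if "n > 0" for n
  proof -
    have "cmod (\<Sum>z\<in>#X n. g z) \<le> (\<Sum>z\<in>#X n. e' + (if z \<notin> nbhd segment \<epsilon> then D else 0))"
      using near D bounded e' by (intro sum_mset_norm_le) (fastforce intro: less_imp_le add_increasing)
    also have "\<dots> = real n * e' + D * real (size {#z \<in># X n. z \<notin> nbhd segment \<epsilon>#})"
      unfolding sum_mset.distrib sum_mset_cond by (simp add: size)
    also have "\<dots> \<le> real n * e' + D * real C"
      using C D(1) by simp
    finally have "cmod (\<Sum>z\<in>#X n. g z) / real n \<le> (real n * e' + D * real C) / real n"
      by (rule divide_right_mono) simp
    moreover have "cmod ((1 / of_nat n) * x) = cmod x / real n" for x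
      by (simp add: norm_divide)
    ultimately show ?thesis
      using that by (simp only:) (simp add: add_divide_distrib)
  qed
  have limit: "cmod (arcsine_mean F - arcsine_mean (poly p)) \<le> e'"
    using F p by (intro arcsine_mean_dist_le less_imp_le) (auto intro!: continuous_intros)
  have ev1: "eventually (\<lambda>n. dist ((1 / of_nat n) * (\<Sum>z\<in>#X n. poly p z)) (arcsine_mean (poly p)) < e') sequentially"
    using poly_averages_tendsto[OF size cheb] e' by (rule tendstoD)
  have "(\<lambda>n. D * real C / real n) \<longlonglongrightarrow> 0"
    by (rule lim_const_over_n)
  then have ev2: "eventually (\<lambda>n. D * real C / real n < e') sequentially"
    using e' by (rule order_tendstoD)
  show "eventually (\<lambda>n. dist ((1 / of_nat n) * (\<Sum>z\<in>#X n. F z)) (arcsine_mean F) < e) sequentially"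
    using ev1 ev2 eventually_gt_at_top[of 0]
  proof eventually_elim
    case (elim n)
    have split: "(1 / of_nat n) * (\<Sum>z\<in>#X n. F z) =
        (1 / of_nat n) * (\<Sum>z\<in>#X n. poly p z) + (1 / of_nat n) * (\<Sum>z\<in>#X n. g z)"
    proof -
      have "(\<Sum>z\<in>#X n. F z) = (\<Sum>z\<in>#X n. poly p z) + (\<Sum>z\<in>#X n. g z)"
        unfolding sum_mset.distrib[symmetric] by (simp add: g_def)
      then show ?thesis by (simp only: distrib_left)
    qed
    have "cmod (((1 / of_nat n) * (\<Sum>z\<in>#X n. poly p z) - arcsine_mean (poly p))
        + (1 / of_nat n) * (\<Sum>z\<in>#X n. g z) - (arcsine_mean F - arcsine_mean (poly p))) < e' + (e' + e') + e'"
      using elim remainder[of n] limit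
      by (smt (verit) dist_norm norm_triangle_ineq norm_triangle_ineq4)
    then show ?case
      unfolding split dist_norm by (simp add: e'_def algebra_simps)
  qed
qed

section \<open>Attraction by the points of the segment\<close>

lemma arcsine_mean_bump:
  assumes "s \<in> segment" and "\<delta> > 0"
  shows "Re (arcsine_mean (\<lambda>z. of_real (max 0 (\<delta> - cmod (z - s))))) > 0"
proof -
  define f where "f t = max 0 (\<delta> - cmod (complex_of_real (2 * cos t) - s))" for t :: real
  have cont: "continuous_on {-pi..pi} f"
    unfolding f_def[abs_def] by (intro continuous_intros)
  obtain x where x: "-2 \<le> x" "x \<le> 2" "s = of_real x" using assms by auto
  have "arccos (x / 2) \<in> {-pi..pi}" "f (arccos (x / 2)) = \<delta>"
    using x assms(2) arccos_lbound[of "x / 2"] arccos_ubound[of "x / 2"]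
    by (auto simp: f_def) 
  then have "integral {-pi..pi} f \<noteq> 0"
    using integral_eq_0_iff[OF cont] assms(2) by (auto simp: f_def)
  moreover have "integral {-pi..pi} f \<ge> 0"
    by (rule integral_nonneg[OF integrable_continuous_real[OF cont]]) (simp add: f_def)
  ultimately have pos: "integral {-pi..pi} f > 0" by simp
  have "((\<lambda>t. complex_of_real (f t)) has_integral of_real (integral {-pi..pi} f)) {-pi..pi}"
    using integrable_continuous_real[OF cont] by (intro has_integral_of_real) (rule integrable_integral)
  then have "integral {-pi..pi} (\<lambda>t. complex_of_real (f t)) = of_real (integral {-pi..pi} f)"
    by (rule integral_unique)
  then show ?thesis
    using pos by (simp add: arcsine_mean_def f_def)
qed

lemma sorted_distance_nth_less:
  assumes "sorted (map (\<lambda>z. cmod (z - s)) L)"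
    and "size {#z \<in># mset L. cmod (z - s) < \<delta>#} > j"
  shows "cmod (L ! j - s) < \<delta>"
proof (rule ccontr)
  assume far: "\<not> cmod (L ! j - s) < \<delta>"
  \<comment> \<open>By sortedness, points closer than \<open>\<delta>\<close> can only occur before position \<open>j\<close>.\<close>
  have "{i. i < length L \<and> cmod (L ! i - s) < \<delta>} \<subseteq> {..<j}"
  proof (rule subsetI, rule ccontr)
    fix i assume i: "i \<in> {i. i < length L \<and> cmod (L ! i - s) < \<delta>}" "i \<notin> {..<j}"
    then have "cmod (L ! j - s) \<le> cmod (L ! i - s)"
      using sorted_nth_mono[OF assms(1), of j i] by simp
    with far i show False by simp
  qed
  then have "card {i. i < length L \<and> cmod (L ! i - s) < \<delta>} \<le> j"
    using card_mono[of "{..<j}"] by fastforce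
  then have "length (filter (\<lambda>z. cmod (z - s) < \<delta>) L) \<le> j"
    by (simp add: length_filter_conv_card)
  with assms(2) show False
    by (simp flip: mset_filter)
qed

text \<open>The sum of a bump function of height and radius \<open>\<delta>\<close> at \<open>s\<close> is at most \<open>\<delta>\<close> times the number of
  eigenvalues within \<open>\<delta>\<close> of \<open>s\<close>. It grows linearly in \<open>n\<close> because the bump has a positive mean, so
  that number eventually exceeds \<open>j\<close>.\<close>

lemma strong_attraction_from_distribution:
  assumes lim: "\<And>F. continuous_on UNIV F \<Longrightarrow>
      (\<lambda>n. (1 / of_nat n) * (\<Sum>z\<in>#eigvals (A n). F z)) \<longlonglongrightarrow> arcsine_mean F"
    and s: "s \<in> segment"
  shows "strongly_attracts_infinite_order s A"
  unfolding strongly_attracts_infinite_order_def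
proof (intro allI impI, rule tendstoI)
  fix L j and \<delta> :: real
  assume L: "\<forall>n. eig_ordering s (A n) (L n)" and \<delta>: "\<delta> > 0"
  define f where "f z = max 0 (\<delta> - cmod (z - s))" for z
  define m where "m = Re (arcsine_mean (\<lambda>z. of_real (f z)))"
  have m: "m > 0"
    using arcsine_mean_bump[OF s \<delta>] by (simp add: m_def f_def)
  have "(\<lambda>n. (1 / of_nat n) * (\<Sum>z\<in>#eigvals (A n). of_real (f z))) \<longlonglongrightarrow> arcsine_mean (\<lambda>z. of_real (f z))"
    by (rule lim) (auto simp: f_def intro!: continuous_intros)
  then have "(\<lambda>n. Re ((1 / of_nat n) * (\<Sum>z\<in>#eigvals (A n). of_real (f z)))) \<longlonglongrightarrow> m"
    unfolding m_def by (rule tendsto_Re)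
  moreover have "Re ((1 / of_nat n) * (\<Sum>z\<in>#X. of_real (f z))) = (\<Sum>z\<in>#X. f z) / real n" for n X
  proof -
    have "(\<Sum>z\<in>#X. complex_of_real (f z)) = of_real (\<Sum>z\<in>#X. f z)"
      by (induction X) auto
    moreover have "Re ((1 / of_nat n) * complex_of_real x) = x / real n" for x
      by simp
    ultimately show ?thesis by (simp only:)
  qed
  ultimately have "(\<lambda>n. (\<Sum>z\<in>#eigvals (A n). f z) / real n) \<longlonglongrightarrow> m"
    by simp
  then have ev1: "eventually (\<lambda>n. (\<Sum>z\<in>#eigvals (A n). f z) / real n > m / 2) sequentially"
    using m by (intro order_tendstoD(1)[of _ m]) auto
  have "(\<lambda>n. \<delta> * real j / real n) \<longlonglongrightarrow> 0"
    by (rule lim_const_over_n)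
  then have ev2: "eventually (\<lambda>n. \<delta> * real j / real n < m / 2) sequentially"
    using m by (intro order_tendstoD(2)[of _ 0]) auto
  show "eventually (\<lambda>n. dist (cmod (L n ! j - s)) 0 < \<delta>) sequentially"
    using ev1 ev2 eventually_gt_at_top[of 0]
  proof eventually_elim
    case (elim n)
    let ?X = "eigvals (A n)"
    have "(\<Sum>z\<in>#?X. f z) \<le> (\<Sum>z\<in>#?X. if cmod (z - s) < \<delta> then \<delta> else 0)"
      using \<delta> by (intro sum_mset_mono) (auto simp: f_def)
    also have "\<dots> = \<delta> * real (size {#z \<in># ?X. cmod (z - s) < \<delta>#})"
      by (rule sum_mset_cond)
    finally have "\<delta> * real j < \<delta> * real (size {#z \<in># ?X. cmod (z - s) < \<delta>#})"
      using elim by (smt (verit) divide_strict_right_mono divide_right_mono of_nat_0_less_iff divide_less_cancel)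
    then have "j < size {#z \<in># ?X. cmod (z - s) < \<delta>#}"
      using \<delta> by simp
    then show ?case
      using L sorted_distance_nth_less[of s "L n" j \<delta>] by (simp add: eig_ordering_def)
  qed
qed

section \<open>Consequences of uniform boundedness in the disc\<close>

lemma power_size_filter_le_prod_mset:
  fixes h :: "'a \<Rightarrow> real"
  assumes "t \<ge> 1" and "\<And>z. P z \<Longrightarrow> t \<le> h z"
  shows "t ^ size (filter_mset P X) \<le> (\<Prod>z\<in>#X. max 1 (h z))"
proof (induction X)
  case (add z X)
  have "(if P z then t else 1) * t ^ size (filter_mset P X) \<le> max 1 (h z) * (\<Prod>z\<in>#X. max 1 (h z))"
    using assms add.IH by (intro mult_mono) (auto simp: le_max_iff_disj)
  then show ?case by (cases "P z") auto
qed simp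

text \<open>A point outside the \<open>\<epsilon>\<close>-neighbourhood has its root in \<open>|u| \<le> r\<close> for a fixed \<open>r < 1\<close>. With any
  \<open>R\<close> strictly between \<open>r\<close> and one, each such point contributes a factor of at least \<open>R / r > 1\<close> to
  Jensen's product, which stays below a constant.\<close>

lemma clustered_if_disc_poly_bounded:
  assumes bnd: "\<And>R. 0 < R \<Longrightarrow> R < 1 \<Longrightarrow> \<exists>M. \<forall>n u. cmod u \<le> R \<longrightarrow> cmod (poly (disc_poly (X n)) u) \<le> M"
    and "\<epsilon> > 0"
  shows "\<exists>C. \<forall>n. size {#z \<in># X n. z \<notin> nbhd segment \<epsilon>#} \<le> C"
proof -
  define r where "r = 1 / (1 + \<epsilon> / 2)"
  define R where "R = (1 + r) / 2"
  have r: "0 < r" "r < 1" using \<open>\<epsilon> > 0\<close> by (auto simp: r_def field_simps)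
  then have R: "r < R" "0 < R" "R < 1" by (auto simp: R_def)
  obtain M where M: "\<And>n u. cmod u \<le> R \<Longrightarrow> cmod (poly (disc_poly (X n)) u) \<le> M"
    using bnd[OF R(2,3)] by blast
  have t: "1 < R / r" using r R by simp
  obtain C where C: "M < (R / r) ^ C" using real_arch_pow[OF t] by blast
  have "size {#z \<in># X n. z \<notin> nbhd segment \<epsilon>#} \<le> C" for n
  proof -
    have "(R / r) ^ size {#z \<in># X n. z \<notin> nbhd segment \<epsilon>#} \<le> (\<Prod>z\<in>#X n. max 1 (R / cmod (disc_root z)))"
    proof (rule power_size_filter_le_prod_mset)
      fix z assume "z \<notin> nbhd segment \<epsilon>"
      then have "cmod (disc_root z) \<le> r"
        unfolding r_def using \<open>\<epsilon> > 0\<close> by (rule disc_root_outside_nbhd)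
      then show "R / r \<le> R / cmod (disc_root z)"
        using R r disc_root(1)[of z] by (intro divide_left_mono) auto
    qed (use t in simp)
    also have "\<dots> \<le> M"
      using R M by (intro jensen_disc_poly) auto
    finally have "(R / r) ^ size {#z \<in># X n. z \<notin> nbhd segment \<epsilon>#} < (R / r) ^ C"
      using C by simp
    then show ?thesis
      using power_less_imp_less_exp[OF t] by (simp add: less_imp_le)
  qed
  then show ?thesis by blast
qed

text \<open>A point of large modulus has a root close to the origin, and this alone makes Jensen's product
  large.\<close>

lemma bounded_if_disc_poly_bounded:
  assumes bnd: "\<And>R. 0 < R \<Longrightarrow> R < 1 \<Longrightarrow> \<exists>M. \<forall>n u. cmod u \<le> R \<longrightarrow> cmod (poly (disc_poly (X n)) u) \<le> M"
  shows "\<exists>B. \<forall>n. \<forall>z\<in>#X n. cmod z \<le> B"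
proof -
  obtain M where M: "\<And>n u. cmod u \<le> 1 / 2 \<Longrightarrow> cmod (poly (disc_poly (X n)) u) \<le> M"
    using bnd[of "1 / 2"] by auto
  have "cmod z \<le> 1 + 2 * M" if "z \<in># X n" for n z
  proof -
    let ?v = "disc_root z"
    let ?t = "max 1 ((1 / 2) / cmod ?v)"
    \<comment> \<open>The copies of \<open>z\<close> alone already contribute \<open>?t ^ ?k\<close> to Jensen's product.\<close>
    let ?k = "size {#y \<in># X n. y = z#}"
    have "?k > 0"
      using multi_member_split[OF that] by auto
    then have "?t ^ 1 \<le> ?t ^ ?k"
      by (intro power_increasing) auto
    also have "\<dots> \<le> (\<Prod>y\<in>#X n. max 1 (max 1 ((1 / 2) / cmod (disc_root y))))"
      by (rule power_size_filter_le_prod_mset) auto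
    also have "\<dots> = (\<Prod>y\<in>#X n. max 1 ((1 / 2) / cmod (disc_root y)))"
      by simp
    also have "\<dots> \<le> M"
      using M by (intro jensen_disc_poly) auto
    finally have "1 / cmod ?v \<le> 2 * M"
      by simp
    moreover have "cmod z \<le> cmod ?v + 1 / cmod ?v"
      using norm_triangle_ineq[of ?v "1 / ?v"] disc_root(3)[of z] by (simp add: norm_divide)
    ultimately show ?thesis
      using disc_root(2)[of z] by linarith
  qed
  then show ?thesis by blast
qed

lemma coeff_bounded_if_disc_poly_bounded:
  assumes bnd: "\<And>R. 0 < R \<Longrightarrow> R < 1 \<Longrightarrow> \<exists>M. \<forall>n u. cmod u \<le> R \<longrightarrow> cmod (poly (disc_poly (X n)) u) \<le> M"
  shows "\<exists>B. \<forall>n. cmod (coeff (disc_poly (X n)) k) \<le> B"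
proof -
  obtain M where M: "\<And>n u. cmod u \<le> 1 / 2 \<Longrightarrow> cmod (poly (disc_poly (X n)) u) \<le> M"
    using bnd[of "1 / 2"] by auto
  have "cmod (coeff (disc_poly (X n)) k) \<le> M * (2 / (1 / 2)) ^ k" for n
    using M by (intro coeff_bound_on_circle) auto
  then show ?thesis by blast
qed

lemma partial_sums_bounded_if_limsup_finite:
  fixes f :: "nat \<Rightarrow> real"
  assumes nonneg: "\<And>j. 0 \<le> f j" and fin: "limsup (\<lambda>n. ereal (\<Sum>j=1..n. f j)) < \<infinity>"
  shows "\<exists>B. \<forall>n. (\<Sum>j=1..n. f j) \<le> B"
proof -
  obtain r where r: "limsup (\<lambda>n. ereal (\<Sum>j=1..n. f j)) < ereal r"
    using fin less_PInf_Ex_of_nat by (metis ereal_dense2)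
  then have "eventually (\<lambda>n. (\<Sum>j=1..n. f j) < r) sequentially"
    using Limsup_lessD[OF r] by simp
  then obtain N where N: "\<And>n. n \<ge> N \<Longrightarrow> (\<Sum>j=1..n. f j) < r"
    by (auto simp: eventually_sequentially)
  have "(\<Sum>j=1..n. f j) \<le> r" for n
  proof -
    have "(\<Sum>j=1..n. f j) \<le> (\<Sum>j=1..max n N. f j)"
      using nonneg by (intro sum_mono2) auto
    also have "\<dots> < r" by (rule N) simp
    finally show ?thesis by simp
  qed
  then show ?thesis by blast
qed

section \<open>The Jacobi matrices\<close>

text \<open>The products \<open>a\<^sub>j c\<^sub>j\<close> that enter the recurrence satisfy
  \<open>1 - a\<^sub>j c\<^sub>j = (1 - a\<^sub>j) + a\<^sub>j (1 - c\<^sub>j)\<close>, so they are summably close to one. The entry \<open>b 0\<close>, which is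
  not controlled by the sums, only enters through the initial values.\<close>

lemma disc_poly_jacobi_bounded:
  fixes a b c :: "nat \<Rightarrow> complex"
  assumes fin: "limsup (\<lambda>n. ereal (\<Sum>j=1..n. cmod (1 - a j) + cmod (b j) + cmod (1 - c j))) < \<infinity>"
    and R: "0 < R" "R < 1"
  shows "\<exists>M. \<forall>n u. cmod u \<le> R \<longrightarrow>
    cmod (poly (disc_poly (eigvals (principal_block (jacobi_entry a b c) n))) u) \<le> M"
proof -
  define Q where "Q n = disc_poly (eigvals (principal_block (jacobi_entry a b c) n))" for n
  define f where "f j = cmod (1 - a j) + cmod (b j) + cmod (1 - c j)" for j
  obtain B where B: "\<And>n. (\<Sum>j=1..n. f j) \<le> B"
    using partial_sums_bounded_if_limsup_finite[of f] fin by (auto simp: f_def)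
  have B0: "0 \<le> B" using B[of 0] by simp
  define \<beta> where "\<beta> k = b (Suc k)" for k
  define \<gamma> where "\<gamma> k = a (Suc k) * c (Suc k)" for k
  have f_le: "f (Suc k) \<le> B" for k
  proof -
    have "f (Suc k) \<le> (\<Sum>j=1..Suc k. f j)"
      by (rule member_le_sum) (auto simp: f_def)
    then show ?thesis using B[of "Suc k"] by linarith
  qed
  have summand_le: "cmod (\<beta> k) + cmod (1 - \<gamma> k) \<le> (1 + B) * f (Suc k)" for k
  proof -
    let ?a = "a (Suc k)" and ?c = "c (Suc k)"
    have "1 - \<gamma> k = (1 - ?a) + ?a * (1 - ?c)"
      by (simp add: \<gamma>_def algebra_simps)
    then have "cmod (1 - \<gamma> k) \<le> cmod (1 - ?a) + cmod ?a * cmod (1 - ?c)"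
      by (metis norm_mult norm_triangle_ineq)
    moreover have "cmod ?a \<le> 1 + B"
    proof -
      have "cmod ?a \<le> 1 + cmod (1 - ?a)"
        using norm_triangle_ineq4[of 1 "1 - ?a"] by simp
      also have "cmod (1 - ?a) \<le> f (Suc k)" by (simp add: f_def)
      finally show ?thesis using f_le[of k] by linarith
    qed
    then have "cmod ?a * cmod (1 - ?c) \<le> (1 + B) * cmod (1 - ?c)"
      by (rule mult_right_mono) simp
    moreover have "0 \<le> B * (cmod (b (Suc k)) + cmod (1 - ?a))" using B0 by simp
    ultimately show ?thesis by (simp add: f_def \<beta>_def algebra_simps)
  qed
  have sum: "(\<Sum>k<n. cmod (\<beta> k) + cmod (1 - \<gamma> k)) \<le> (1 + B) * B" for n
  proof -
    have "(\<Sum>k<n. cmod (\<beta> k) + cmod (1 - \<gamma> k)) \<le> (\<Sum>k<n. (1 + B) * f (Suc k))"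
      by (intro sum_mono summand_le)
    also have "\<dots> = (1 + B) * (\<Sum>j=1..n. f j)"
      by (simp add: sum_distrib_left sum.atLeast1_atMost_eq)
    also have "\<dots> \<le> (1 + B) * B"
      using B B0 by (intro mult_left_mono) auto
    finally show ?thesis .
  qed
  define K where "K = 1 / (1 - R\<^sup>2)"
  have K: "K \<ge> 0"
    using R by (simp add: K_def power_le_one)
  define M where "M = (2 + cmod (b 0) + K * (1 + cmod (b 0))) * exp ((1 + K) * ((1 + B) * B))"
  have "cmod (poly (Q n) u) \<le> max 1 M" if u: "cmod u \<le> R" for n u
  proof (cases n)
    case 0
    then show ?thesis by (simp add: Q_def disc_poly_jacobi(1))
  next
    case (Suc m)
    have u1: "cmod u \<le> 1" "cmod (u\<^sup>2) \<le> 1"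
      using u R by (auto simp: norm_power power_le_one)
    have Q0: "poly (Q 0) u = 1" and Q1: "poly (Q 1) u = 1 - b 0 * u + u\<^sup>2"
      by (simp_all add: Q_def disc_poly_jacobi algebra_simps power2_eq_square)
    have rec: "poly (Q (Suc (Suc n))) u =
        (1 - \<beta> n * u + u\<^sup>2) * poly (Q (Suc n)) u - \<gamma> n * u\<^sup>2 * poly (Q n) u" for n
      unfolding Q_def disc_poly_jacobi(3) by (simp add: \<beta>_def \<gamma>_def algebra_simps power2_eq_square)
    have bu: "cmod (b 0 * u) \<le> cmod (b 0)"
      using u1 by (simp add: norm_mult mult_left_le)
    have diff: "poly (Q 1) u - poly (Q 0) u = u\<^sup>2 - b 0 * u"
      unfolding Q0 Q1 by simp
    have d: "cmod (poly (Q 1) u - poly (Q 0) u) \<le> 1 + cmod (b 0)"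
      unfolding diff using norm_triangle_ineq4[of "u\<^sup>2" "b 0 * u"] bu u1 by linarith
    have q1: "cmod (poly (Q 1) u) \<le> 2 + cmod (b 0)"
      using norm_triangle_sub[of "poly (Q 1) u" "poly (Q 0) u"] d unfolding Q0 by simp
    have "cmod (poly (Q (Suc m)) u) \<le>
        (cmod (poly (Q 1) u) + K * cmod (poly (Q 1) u - poly (Q 0) u)) * exp ((1 + K) * ((1 + B) * B))"
      unfolding K_def using rec u R(2) sum by (rule perturbed_recurrence_bound)
    also have "\<dots> \<le> M"
      unfolding M_def using d q1 K by (intro mult_right_mono add_mono mult_left_mono) auto
    finally show ?thesis by (simp add: Suc)
  qed
  then show ?thesis unfolding Q_def by blast
qed

theorem corollary3p8:
  fixes a b c :: "nat \<Rightarrow> complex" and A :: "nat \<Rightarrow> complex mat"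
  assumes A_def: "A = principal_block (jacobi_entry a b c)"
    and bounded_entries: "(SUP n\<in>{1..}. ereal (cmod (a n) + cmod (b n) + cmod (c n))) < \<infinity>"
    and limsup_finite:
      "limsup (\<lambda>n. ereal (\<Sum>j=1..n. cmod (1 - a j) + cmod (b j) + cmod (1 - c j))) < \<infinity>"
  shows "eig_distributed A (\<lambda>t::real. complex_of_real (2 * cos t)) {-pi..pi}
    \<and> strongly_clustered A (complex_of_real ` {-2..2})
    \<and> (\<forall>s\<in>complex_of_real ` {-2..2}. strongly_attracts_infinite_order s A)"
proof -
  define X where "X n = eigvals (A n)" for n
  have size: "size (X n) = n" for n
    using matrix_sequence_principal_block unfolding X_def A_def matrix_sequence_def
    by (intro size_eigvals) auto
  have bnd: "\<exists>M. \<forall>n u. cmod u \<le> R \<longrightarrow> cmod (poly (disc_poly (X n)) u) \<le> M" if "0 < R" "R < 1" for R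
    unfolding X_def A_def using limsup_finite that by (rule disc_poly_jacobi_bounded)
  have cluster: "\<exists>C. \<forall>n. size {#z \<in># X n. z \<notin> nbhd segment \<epsilon>#} \<le> C" if "\<epsilon> > 0" for \<epsilon>
    using bnd that by (rule clustered_if_disc_poly_bounded)
  obtain B where B: "\<And>n z. z \<in># X n \<Longrightarrow> cmod z \<le> B"
    using bounded_if_disc_poly_bounded[OF bnd] by blast
  have lim: "(\<lambda>n. (1 / of_nat n) * (\<Sum>z\<in>#X n. F z)) \<longlonglongrightarrow> arcsine_mean F"
    if "continuous_on UNIV F" for F
    by (rule averages_tendsto[OF size cheb_sum_bounded[OF coeff_bounded_if_disc_poly_bounded[OF bnd]]
        cluster B that])
  have "compact segment"
    by (intro compact_continuous_image continuous_intros) auto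
  then have "strongly_clustered A segment"
    using cluster by (auto simp: strongly_clustered_def X_def compact_imp_closed)
  moreover have "eig_distributed A (\<lambda>t::real. complex_of_real (2 * cos t)) {-pi..pi}"
    unfolding eig_distributed_def
  proof (intro conjI allI impI)
    show "(\<lambda>t::real. complex_of_real (2 * cos t)) \<in> borel_measurable (lebesgue_on {-pi..pi})"
      by (intro continuous_imp_measurable_on_sets_lebesgue continuous_intros) auto
    fix F :: "complex \<Rightarrow> complex" assume "continuous_on UNIV F \<and> bounded {z. F z \<noteq> 0}"
    then have "continuous_on UNIV F" by simp
    from lim[OF this] show "(\<lambda>n. (1 / of_nat n) * (\<Sum>z\<in>#eigvals (A n). F z)) \<longlonglongrightarrow>
        (1 / of_real (measure lebesgue {-pi..pi})) * (LINT t|lebesgue_on {-pi..pi}. F (of_real (2 * cos t)))"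
      unfolding arcsine_mean_lebesgue[OF \<open>continuous_on UNIV F\<close>] X_def .
  qed auto
  moreover have "strongly_attracts_infinite_order s A" if "s \<in> segment" for s
    using lim that unfolding X_def by (rule strong_attraction_from_distribution)
  ultimately show ?thesis by blast
qed

end
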